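(* Let $p<0.5$ ($p\in(0,1)$), and let $K,c_0\in\mathbb{R}$. The solution of the optimization problem (over constant mix strategies $\mathbf{x}\in\mathbb{R}^m$) $$\max_{\mathbf{x}}\ \mathbb{E}(W_\tau^{'L})\quad\text{subject to}\quad CLVaR_p(W_\tau^{'L})\ge K,\qquad \mu(\mathbf{x})\le c_0,$$ where $$W_\tau^{'L}=c_5+c_6\,(\boldsymbol{\mu}-r\mathbf{1})^\top\mathbf{x}-c_7\,(\mathbf{x}^\top\mathbf{\Sigma}\,\mathbf{x})+c_8\,\frac{\Lambda}{\sigma_\Lambda}\sqrt{\mathbf{x}^\top\mathbf{\Sigma}\,\mathbf{x}},$$ is of the form $\mathbf{x}=q\,\mathbf{x}^\star$, where $\mathbf{x}^\star=\mathbf{\Sigma}^{-1}(\boldsymbol{\mu}-r\mathbf{1})$ and $q=\min\{q_1,q_2,q_3\}$ with $$q_1=\frac{-B_2-\sqrt{B_2^2-4B_1B_3}}{2B_1},\qquad q_2=\frac{c_6}{2c_7},\qquad q_3=\frac{c_0-r}{(\boldsymbol{\mu}-r\mathbf{1})^\top\mathbf{\Sigma}^{-1}(\boldsymbol{\mu}-r\mathbf{1})},$$ $$B_1=-c_7\,(\boldsymbol{\mu}-r\mathbf{1})^\top\mathbf{\Sigma}^{-1}(\boldsymbol{\mu}-r\mathbf{1}),\qquad B_2=\frac{c_6}{-c_7}B_1-c_9\sqrt{\frac{B_1}{-c_7}},\qquad B_3=c_5-K.$$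
   Context: Risk measures: for a random variable $X$ with distribution function $F_X$ and $p\in(0,1)$, $VaR_p(X)=\inf\{x\in\mathbb{R}:F_X(x)\ge p\}$, $CVaR_p(X)=\mathbb{E}(X\mid X>VaR_p(X))$ and $CLVaR_p(X)=\mathbb{E}(X\mid X<VaR_p(X))$; one has $CVaR_{1-p}(X)=-CLVaR_p(-X)$. $\tau$ is a positive integer; $\alpha_0,\dots,\alpha_{\tau-1}\ge0$ are periodic endowments, not all zero; $r>0$ is the risk-free rate; $\mathbf{x}\in\mathbb{R}^m$ is the vector of constant fractions of wealth in $m$ risky assets; $\mathbf{1}=(1,\dots,1)^\top$; $B'_1,\dots,B'_m$ are jointly Gaussian standard Brownian motions with $\mathrm{Cov}(B'_i(t),B'_j(t+s))=t\rho_{i,j}$ for $t,s\ge0$; $\sigma_j>0$ are volatilities; $\mathbf{\Sigma}=(\sigma_i\sigma_j\rho_{i,j})_{i,j}$ is invertible; $B_{\mathbf{x}}(t)=\frac{1}{\mathbf{x}^\top\mathbf{\Sigma}\mathbf{x}}\sum_jx_j\sigma_jB'_j(t)$; $V_t=(\mathbf{x}^\top\mathbf{\Sigma}\mathbf{x})(B_{\mathbf{x}}(\tau)-B_{\mathbf{x}}(t))$; $\Lambda=\sum_{t=0}^{\tau-1}\alpha_tV_t$ with standard deviation $\sigma_\Lambda$ (so $\Lambda/\sigma_\Lambda$ is standard normal). $\lambda,\lambda_j$ are jump intensities, $Z_{k,j,\ell}$ ($\ell=0,1$) are real random jump magnitudes, $h_{j,\ell}=\mathbb{E}[e^{Z_{k,j,\ell}}]-1$,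 $\mu_j\in\mathbb{R}$ are drifts, $\boldsymbol{\mu}=(r+\mu_1-\lambda h_{1,0}-\lambda_1h_{1,1},\dots,r+\mu_m-\lambda h_{m,0}-\lambda_mh_{m,1})^\top$ and $\mu(\mathbf{x})=(\boldsymbol{\mu}-r\mathbf{1})^\top\mathbf{x}+r$. $Z^\star_{k,j,\ell}(\mathbf{x})$ is given by $e^{Z^\star_{k,j,\ell}(\mathbf{x})}-1=x_j(e^{Z_{k,j,\ell}}-1)$, and $M_Z(\theta)=\mathbb{E}(e^{\theta Z})$. The constants are $$c_{2,t}=(\tau-t)r+\lambda(\tau-t)\Big(\prod_{j=1}^{m}M_{Z^\star_{1,j,0}(\mathbf{x})}(1)-1\Big)+\sum_{j=1}^{m}\lambda_j(\tau-t)\Big(M_{Z^\star_{1,j,1}(\mathbf{x})}(1)-1\Big),$$ $$c_5=\sum_{t=0}^{\tau-1}\alpha_t(1+c_{2,t}),\qquad c_6=\sum_{t=0}^{\tau-1}\alpha_t(\tau-t),$$ $$c_7=\sum_{t=0}^{\tau-1}\alpha_t\frac{\big(\sum_{l=0}^{\tau-1}\alpha_l\min\{\tau-t,\tau-l\}\big)^2}{2\sum_{k,l=0}^{\tau-1}\alpha_k\alpha_l\min\{\tau-k,\tau-l\}},\qquad c_8=\sum_{t=0}^{\tau-1}\alpha_t\frac{\sum_{l=0}^{\tau-1}\alpha_l\min\{\tau-t,\tau-l\}}{\sqrt{\sum_{k,l=0}^{\tau-1}\alpha_k\alpha_l\min\{\tau-k,\tau-l\}}},$$ $$c_9=c_8\,\frac{1}{p\sqrt{2\pi}}\,e^{-\frac12(\Phi^{-1}(p))^2},$$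 with $\Phi$ the standard normal distribution function. In the optimization problem, $c_{2,t}$ (through the values $M_{Z^\star_{1,j,\ell}(\mathbf{x})}(1)$), and hence $c_5$, is treated as a constant not depending on the decision variable $\mathbf{x}$. *)

theory Defs
  imports "HOL-Probability.Probability"
begin

section \<open>Gaussian processes and Brownian motion\<close>

definition covariance :: "'a measure \<Rightarrow> ('a \<Rightarrow> real) \<Rightarrow> ('a \<Rightarrow> real) \<Rightarrow> real" where
  "covariance M X Y =
     integral\<^sup>L M (\<lambda>\<omega>. (X \<omega> - integral\<^sup>L M X) * (Y \<omega> - integral\<^sup>L M Y))"

definition std_deviation :: "'a measure \<Rightarrow> ('a \<Rightarrow> real) \<Rightarrow> real" where
  "std_deviation M X = sqrt (covariance M X X)"

(* Gaussian in the wide sense: almost surely constant variables are included, as they must be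
   for "every linear combination is Gaussian" to be a sensible requirement. *)
definition gaussian_rv :: "'a measure \<Rightarrow> ('a \<Rightarrow> real) \<Rightarrow> bool" where
  "gaussian_rv M X \<longleftrightarrow> X \<in> borel_measurable M \<and>
     ((\<exists>m s. s > 0 \<and> distributed M lborel X (\<lambda>x. ennreal (normal_density m s x))) \<or>
      (\<exists>m. AE \<omega> in M. X \<omega> = m))"

definition jointly_gaussian :: "'a measure \<Rightarrow> 'i set \<Rightarrow> ('i \<Rightarrow> 'a \<Rightarrow> real) \<Rightarrow> bool" where
  "jointly_gaussian M I X \<longleftrightarrow>
     (\<forall>F c. finite F \<and> F \<subseteq> I \<longrightarrow> gaussian_rv M (\<lambda>\<omega>. \<Sum>i\<in>F. c i * X i \<omega>))"

definition standard_brownian_motion :: "'a measure \<Rightarrow> (real \<Rightarrow> 'a \<Rightarrow> real) \<Rightarrow> bool" where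
  "standard_brownian_motion M B \<longleftrightarrow>
     (\<forall>t\<ge>0. B t \<in> borel_measurable M) \<and>
     (AE \<omega> in M. B 0 \<omega> = 0) \<and>
     (\<forall>s t. 0 \<le> s \<and> s < t \<longrightarrow>
        distributed M lborel (\<lambda>\<omega>. B t \<omega> - B s \<omega>)
          (\<lambda>x. ennreal (normal_density 0 (sqrt (t - s)) x))) \<and>
     (\<forall>(u :: nat \<Rightarrow> real) n. 0 \<le> u 0 \<and> mono u \<longrightarrow>
        prob_space.indep_vars M (\<lambda>_. borel) (\<lambda>i \<omega>. B (u (Suc i)) \<omega> - B (u i) \<omega>) {..<n}) \<and>
     (AE \<omega> in M. continuous_on {0..} (\<lambda>t. B t \<omega>))"


section \<open>Risk measures\<close>

definition VaR :: "'a measure \<Rightarrow> real \<Rightarrow> ('a \<Rightarrow> real) \<Rightarrow> real" where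
  "VaR M p X = Inf {x. cdf (distr M borel X) x \<ge> p}"

definition cond_expectation_on :: "'a measure \<Rightarrow> ('a \<Rightarrow> real) \<Rightarrow> 'a set \<Rightarrow> real" where
  "cond_expectation_on M X A = (LINT \<omega>:A|M. X \<omega>) / measure M A"

(* E(X | X < VaR_p(X)).  The conditioning event is null when X has no mass below its p-quantile,
   in particular when X is constant; the value is then VaR_p(X), so that a constant c has
   CLVaR c.  Division by zero would give the meaningless value 0 instead. *)
definition CLVaR :: "'a measure \<Rightarrow> real \<Rightarrow> ('a \<Rightarrow> real) \<Rightarrow> real" where
  "CLVaR M p X =
     (let A = {\<omega> \<in> space M. X \<omega> < VaR M p X}
      in if measure M A > 0 then cond_expectation_on M X A else VaR M p X)"

(* The standard normal distribution function is a bijection from the reals onto {0<..<1},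
   so the inverse is determined at every p strictly between 0 and 1. *)
definition std_normal_quantile :: "real \<Rightarrow> real" where
  "std_normal_quantile p = inv (cdf std_normal_distribution) p"


section \<open>The market\<close>

definition vol_cov_matrix :: "('m::finite \<Rightarrow> real) \<Rightarrow> ('m \<Rightarrow> 'm \<Rightarrow> real) \<Rightarrow> real^'m^'m" where
  "vol_cov_matrix \<sigma> \<rho> = (\<chi> i j. \<sigma> i * \<sigma> j * \<rho> i j)"

definition quad_form :: "real^'m^'m \<Rightarrow> real^'m \<Rightarrow> real" where
  "quad_form S x = x \<bullet> (S *v x)"

definition drift_vector ::
  "real \<Rightarrow> ('m::finite \<Rightarrow> real) \<Rightarrow> real \<Rightarrow> ('m \<Rightarrow> real) \<Rightarrow> ('m \<Rightarrow> nat \<Rightarrow> real) \<Rightarrow> real^'m" where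
  "drift_vector r \<mu> lam0 lam h = (\<chi> j. r + \<mu> j - lam0 * h j 0 - lam j * h j 1)"

definition mgf :: "'a measure \<Rightarrow> ('a \<Rightarrow> real) \<Rightarrow> real \<Rightarrow> real" where
  "mgf M Z \<theta> = integral\<^sup>L M (\<lambda>\<omega>. exp (\<theta> * Z \<omega>))"

definition jump_star :: "real \<Rightarrow> ('a \<Rightarrow> real) \<Rightarrow> 'a \<Rightarrow> real" where
  "jump_star a Z \<omega> = ln (1 + a * (exp (Z \<omega>) - 1))"

lemma exp_jump_star:
  assumes "1 + a * (exp (Z \<omega>) - 1) > 0"
  shows "exp (jump_star a Z \<omega>) - 1 = a * (exp (Z \<omega>) - 1)"
  using assms by (simp add: jump_star_def)

definition mix_process ::
  "real^'m^'m \<Rightarrow> ('m::finite \<Rightarrow> real) \<Rightarrow> ('m \<Rightarrow> real \<Rightarrow> 'a \<Rightarrow> real) \<Rightarrow> real^'m \<Rightarrow> real \<Rightarrow> 'a \<Rightarrow> real"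
  where "mix_process S \<sigma> B x t \<omega> = 1 / quad_form S x * (\<Sum>j\<in>UNIV. x $ j * \<sigma> j * B j t \<omega>)"

definition V_rv ::
  "real^'m^'m \<Rightarrow> ('m::finite \<Rightarrow> real) \<Rightarrow> ('m \<Rightarrow> real \<Rightarrow> 'a \<Rightarrow> real) \<Rightarrow> nat \<Rightarrow> real^'m \<Rightarrow> nat \<Rightarrow> 'a \<Rightarrow> real"
  where "V_rv S \<sigma> B \<tau> x t \<omega> =
     quad_form S x * (mix_process S \<sigma> B x (real \<tau>) \<omega> - mix_process S \<sigma> B x (real t) \<omega>)"

definition Lambda_rv ::
  "real^'m^'m \<Rightarrow> ('m::finite \<Rightarrow> real) \<Rightarrow> ('m \<Rightarrow> real \<Rightarrow> 'a \<Rightarrow> real) \<Rightarrow> nat \<Rightarrow> (nat \<Rightarrow> real) \<Rightarrow> real^'m \<Rightarrow> 'a \<Rightarrow> real"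
  where "Lambda_rv S \<sigma> B \<tau> \<alpha> x \<omega> = (\<Sum>t<\<tau>. \<alpha> t * V_rv S \<sigma> B \<tau> x t \<omega>)"


section \<open>The constants\<close>

(* The portfolio y at which the jump transforms are evaluated is a parameter of its own, separate
   from the decision variable: the optimization treats these transforms as constants. *)
definition const2 ::
  "'a measure \<Rightarrow> (nat \<Rightarrow> 'm::finite \<Rightarrow> nat \<Rightarrow> 'a \<Rightarrow> real) \<Rightarrow> real^'m \<Rightarrow> real \<Rightarrow> real \<Rightarrow> ('m \<Rightarrow> real) \<Rightarrow>
     nat \<Rightarrow> nat \<Rightarrow> real" where
  "const2 M Z y r lam0 lam \<tau> t =
     (real \<tau> - real t) * r
     + lam0 * (real \<tau> - real t) * ((\<Prod>j\<in>UNIV. mgf M (jump_star (y $ j) (Z 1 j 0)) 1) - 1)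
     + (\<Sum>j\<in>UNIV. lam j * (real \<tau> - real t) * (mgf M (jump_star (y $ j) (Z 1 j 1)) 1 - 1))"

definition const5 ::
  "'a measure \<Rightarrow> (nat \<Rightarrow> 'm::finite \<Rightarrow> nat \<Rightarrow> 'a \<Rightarrow> real) \<Rightarrow> real^'m \<Rightarrow> real \<Rightarrow> real \<Rightarrow> ('m \<Rightarrow> real) \<Rightarrow>
     nat \<Rightarrow> (nat \<Rightarrow> real) \<Rightarrow> real" where
  "const5 M Z y r lam0 lam \<tau> \<alpha> = (\<Sum>t<\<tau>. \<alpha> t * (1 + const2 M Z y r lam0 lam \<tau> t))"

definition const6 :: "nat \<Rightarrow> (nat \<Rightarrow> real) \<Rightarrow> real" where
  "const6 \<tau> \<alpha> = (\<Sum>t<\<tau>. \<alpha> t * (real \<tau> - real t))"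

definition const7 :: "nat \<Rightarrow> (nat \<Rightarrow> real) \<Rightarrow> real" where
  "const7 \<tau> \<alpha> =
     (\<Sum>t<\<tau>. \<alpha> t * ((\<Sum>l<\<tau>. \<alpha> l * min (real \<tau> - real t) (real \<tau> - real l))\<^sup>2
        / (2 * (\<Sum>k<\<tau>. \<Sum>l<\<tau>. \<alpha> k * \<alpha> l * min (real \<tau> - real k) (real \<tau> - real l)))))"

definition const8 :: "nat \<Rightarrow> (nat \<Rightarrow> real) \<Rightarrow> real" where
  "const8 \<tau> \<alpha> =
     (\<Sum>t<\<tau>. \<alpha> t * ((\<Sum>l<\<tau>. \<alpha> l * min (real \<tau> - real t) (real \<tau> - real l))
        / sqrt (\<Sum>k<\<tau>. \<Sum>l<\<tau>. \<alpha> k * \<alpha> l * min (real \<tau> - real k) (real \<tau> - real l))))"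

definition const9 :: "nat \<Rightarrow> (nat \<Rightarrow> real) \<Rightarrow> real \<Rightarrow> real" where
  "const9 \<tau> \<alpha> p =
     const8 \<tau> \<alpha> * (1 / (p * sqrt (2 * pi))) * exp (- (1/2) * (std_normal_quantile p)\<^sup>2)"

end

theory Submission
  imports Defs "HOL-Real_Asymp.Real_Asymp"
begin

text \<open>
  For \<open>x \<noteq> 0\<close> the wealth is \<open>a + b N\<close> with \<open>N\<close> standard normal and \<open>b = c8 \<surd>Q(x)\<close>, where \<open>Q\<close> is the
  quadratic form of \<open>\<Sigma>\<close>. Hence its expectation is \<open>a = c5 + c6 (e \<bullet> x) - c7 Q(x)\<close>, with \<open>e = \<mu> - r 1\<close>,
  and its lower tail expectation is \<open>a - c9 \<surd>Q(x)\<close>.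
  With \<open>A = e \<bullet> xstar = Q(xstar)\<close> and \<open>u = (e \<bullet> x) / A\<close> we have \<open>Q(x - u xstar) = Q(x) - u\<^sup>2 A\<close>: passing
  from \<open>x\<close> to \<open>u xstar\<close> keeps \<open>e \<bullet> x\<close>, lowers \<open>Q\<close>, and so improves the objective and preserves
  feasibility. What remains is a concave quadratic problem in the single variable \<open>u\<close>.
\<close>

section \<open>The standard normal distribution function, its quantile and its partial mean\<close>

abbreviation \<Phi> :: "real \<Rightarrow> real" where
  "\<Phi> \<equiv> cdf std_normal_distribution"

interpretation std_normal: real_distribution std_normal_distribution
  by (rule real_dist_normal_dist)

text \<open>A distribution function is continuous wherever its measure has no atom, and a measure
  with a Lebesgue density has none.\<close>

lemma continuous_std_normal_cdf: "isCont \<Phi> x"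
proof -
  have "{x} \<in> null_sets std_normal_distribution"
  proof -
    have "AE z in lborel. z \<in> {x} \<longrightarrow> ennreal (std_normal_density z) = 0"
      using AE_lborel_singleton[of x] by eventually_elim simp
    then show ?thesis by (simp add: null_sets_density_iff)
  qed
  then show ?thesis
    by (simp add: std_normal.isCont_cdf measure_eq_0_null_sets)
qed

text \<open>The density is positive everywhere, so an interval that is null for the normal law would
  be Lebesgue null.\<close>

lemma strict_mono_std_normal_cdf: "strict_mono \<Phi>"
proof (rule strict_monoI)
  fix x y :: real
  assume "x < y"
  have "{x<..y} \<notin> null_sets std_normal_distribution"
  proof
    assume "{x<..y} \<in> null_sets std_normal_distribution"
    then have "AE z in lborel. z \<in> {x<..y} \<longrightarrow> std_normal_density z \<le> 0"
      by (subst (asm) null_sets_density_iff) (auto simp: ennreal_eq_0_iff)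
    moreover have "\<not> std_normal_density z \<le> 0" for z
      using normal_density_pos[of 1 0 z] by simp
    ultimately have "AE z in lborel. z \<notin> {x<..y}"
      by simp
    then have "emeasure lborel {x<..y} = 0"
      by (subst (asm) AE_iff_measurable[of "{x<..y}"]) auto
    then show False
      using \<open>x < y\<close> by simp
  qed
  then have "measure std_normal_distribution {x<..y} \<noteq> 0"
    by (auto simp: null_sets_def std_normal.emeasure_eq_measure)
  then have "0 < measure std_normal_distribution {x<..y}"
    by (simp add: zero_less_measure_iff)
  then show "\<Phi> x < \<Phi> y"
    using std_normal.cdf_diff_eq[OF \<open>x < y\<close>] by simp
qed

text \<open>The quantile is a choice inverse, so it suffices that \<open>p\<close> is attained: the
  limits 0 and 1 at the two ends and the intermediate value theorem give this.\<close>

lemma std_normal_cdf_quantile: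
  assumes "0 < p" "p < 1"
  shows "\<Phi> (std_normal_quantile p) = p"
proof -
  obtain a where a: "\<Phi> a < p"
    using order_tendstoD(2)[OF std_normal.cdf_lim_at_bot \<open>0 < p\<close>]
    by (auto simp: eventually_at_bot_linorder)
  obtain b where b: "p < \<Phi> b"
    using order_tendstoD(1)[OF std_normal.cdf_lim_at_top_prob \<open>p < 1\<close>]
    by (auto simp: eventually_at_top_linorder)
  have "a < b"
    using a b strict_mono_less[OF strict_mono_std_normal_cdf, of a b] by linarith
  then obtain x where "\<Phi> x = p"
    using IVT[of \<Phi> a p b] a b continuous_std_normal_cdf by auto
  then show ?thesis
    unfolding std_normal_quantile_def by (metis f_inv_into_f rangeI)
qed

text \<open>\<open>- std_normal_density\<close> is an antiderivative of the integrand and vanishes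
  at minus infinity.\<close>

lemma std_normal_partial_expectation:
  "(LBINT x:{..<z}. x * std_normal_density x) = - std_normal_density z"
proof -
  have int: "integrable lborel (\<lambda>x. x * std_normal_density x)"
    using integrable_std_normal_moment[of 1] by (simp add: mult.commute)
  have "(LBINT x=-\<infinity>..ereal z. x * std_normal_density x) = - std_normal_density z - 0"
  proof (rule interval_integral_FTC_integrable[where F="\<lambda>x. - std_normal_density x"])
    show "((\<lambda>x. - std_normal_density x) has_vector_derivative x * std_normal_density x) (at x)" for x
      unfolding std_normal_density_def has_real_derivative_iff_has_vector_derivative[symmetric]
      by (auto intro!: derivative_eq_intros simp: field_simps)
    show "isCont (\<lambda>x. x * std_normal_density x) x" for x
      unfolding std_normal_density_def by (intro continuous_intros) auto
    show "set_integrable lborel (einterval (-\<infinity>) (ereal z)) (\<lambda>x. x * std_normal_density x)"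
      unfolding set_integrable_def by (intro integrable_mult_indicator int) auto
    have "((\<lambda>x::real. - ((1 / sqrt (2 * pi)) * exp (- x\<^sup>2 / 2))) \<longlongrightarrow> 0) at_bot"
      by real_asymp
    then show "(((\<lambda>x. - std_normal_density x) \<circ> real_of_ereal) \<longlongrightarrow> 0) (at_right (-\<infinity>))"
      unfolding std_normal_density_def by (simp add: ereal_tendsto_simps)
    have "isCont (\<lambda>x. - std_normal_density x) z"
      unfolding std_normal_density_def by (intro continuous_intros) auto
    then have "((\<lambda>x. - std_normal_density x) \<longlongrightarrow> - std_normal_density z) (at_left z)"
      by (auto simp: isCont_def intro: filterlim_at_within_not_equal tendsto_within_subset)
    then show "(((\<lambda>x. - std_normal_density x) \<circ> real_of_ereal) \<longlongrightarrow> - std_normal_density z) (at_left (ereal z))"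
      by (simp add: ereal_tendsto_simps)
  qed auto
  moreover have "einterval (-\<infinity>) (ereal z) = {..<z}"
    by (auto simp: einterval_def)
  ultimately show ?thesis
    by (simp add: interval_lebesgue_integral_def)
qed

section \<open>VaR and CLVaR of affine functions of a standard normal variable and of
  constants\<close>

context prob_space
begin

context
  fixes N :: "'a \<Rightarrow> real"
  assumes N: "distributed M lborel N std_normal_density"
begin

lemma std_normal_measurable[measurable]: "N \<in> borel_measurable M"
  using distributed_measurable[OF N] by simp

lemma distr_std_normal: "distr M borel N = std_normal_distribution"
  using distributed_distr_eq_density[OF N] by (simp cong: distr_cong)

lemma prob_std_normal_le: "prob {\<omega> \<in> space M. N \<omega> \<le> z} = \<Phi> z"
proof -
  have "\<Phi> z = measure (distr M borel N) {..z}"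
    by (simp add: distr_std_normal cdf_def)
  also have "\<dots> = prob (N -` {..z} \<inter> space M)"
    by (rule measure_distr) auto
  also have "N -` {..z} \<inter> space M = {\<omega> \<in> space M. N \<omega> \<le> z}" by auto
  finally show ?thesis by simp
qed

text \<open>\<open>CLVaR\<close> conditions on a strict inequality. The mass of that event is a left
  limit of \<open>\<Phi>\<close>, which continuity identifies with the value.\<close>

lemma prob_std_normal_less: "prob {\<omega> \<in> space M. N \<omega> < z} = \<Phi> z"
proof -
  have "prob {\<omega> \<in> space M. N \<omega> < z} = prob (N -` {..<z} \<inter> space M)"
    by (rule arg_cong[where f=prob]) auto
  also have "\<dots> = measure (distr M borel N) {..<z}"
    by (rule measure_distr[symmetric]) auto
  also have "\<dots> = \<Phi> z"
    unfolding distr_std_normal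
    using std_normal.cdf_at_left[of z] continuous_std_normal_cdf[of z]
    by (metis continuous_at_split continuous_within tendsto_unique trivial_limit_at_left_real)
  finally show ?thesis .
qed

text \<open>Strict monotonicity of \<open>\<Phi>\<close> turns the set in the definition of
  \<open>VaR\<close> into a closed half-line, and the infimum is its endpoint.\<close>

lemma VaR_affine_std_normal:
  assumes "0 < b" "0 < p" "p < 1"
  shows "VaR M p (\<lambda>\<omega>. a + b * N \<omega>) = a + b * std_normal_quantile p"
proof -
  have "cdf (distr M borel (\<lambda>\<omega>. a + b * N \<omega>)) x = \<Phi> ((x - a) / b)" for x
  proof -
    have "cdf (distr M borel (\<lambda>\<omega>. a + b * N \<omega>)) x = prob ((\<lambda>\<omega>. a + b * N \<omega>) -` {..x} \<inter> space M)"
      unfolding cdf_def by (rule measure_distr) auto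
    also have "(\<lambda>\<omega>. a + b * N \<omega>) -` {..x} \<inter> space M = {\<omega> \<in> space M. N \<omega> \<le> (x - a) / b}"
      using \<open>0 < b\<close> by (auto simp: field_simps)
    finally show ?thesis by (simp add: prob_std_normal_le)
  qed
  moreover have "p \<le> \<Phi> ((x - a) / b) \<longleftrightarrow> a + b * std_normal_quantile p \<le> x" for x
  proof -
    have "p \<le> \<Phi> ((x - a) / b) \<longleftrightarrow> std_normal_quantile p \<le> (x - a) / b"
      using strict_mono_less_eq[OF strict_mono_std_normal_cdf] std_normal_cdf_quantile assms by metis
    then show ?thesis using \<open>0 < b\<close> by (simp add: field_simps)
  qed
  ultimately have "{x. p \<le> cdf (distr M borel (\<lambda>\<omega>. a + b * N \<omega>)) x} = {a + b * std_normal_quantile p..}"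
    by auto
  then show ?thesis by (simp add: VaR_def)
qed

text \<open>For \<open>b > 0\<close> the event below the quantile is always \<open>N < z\<close>, of
  probability \<open>p\<close>, so only the partial mean of \<open>N\<close> is needed. The quotient
  of the density by \<open>p\<close> is the factor that turns \<open>const8\<close> into
  \<open>const9\<close>.\<close>

lemma CLVaR_affine_std_normal:
  assumes "0 < b" "0 < p" "p < 1"
  shows "CLVaR M p (\<lambda>\<omega>. a + b * N \<omega>) = a - b * std_normal_density (std_normal_quantile p) / p"
proof -
  define z where "z = std_normal_quantile p"
  define A where "A = {\<omega> \<in> space M. N \<omega> < z}"
  have [measurable]: "A \<in> sets M" unfolding A_def by measurable
  have prob_A: "prob A = p"
    unfolding A_def z_def prob_std_normal_less using std_normal_cdf_quantile assms by simp
  have int_N: "integrable M N"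
    using distributed_integrable_var[OF N] integrable_std_normal_moment[of 1] by simp
  have ind: "indicator A \<omega> * N \<omega> = indicator {..<z} (N \<omega>) * N \<omega>" if "\<omega> \<in> space M" for \<omega>
    using that by (auto simp: A_def indicator_def)
  have "(LINT \<omega>:A|M. N \<omega>) = (LINT \<omega>|M. indicator {..<z} (N \<omega>) * N \<omega>)"
    unfolding set_lebesgue_integral_def by (intro Bochner_Integration.integral_cong) (auto simp: ind)
  also have "\<dots> = (LBINT x. std_normal_density x * (indicator {..<z} x * x))"
    by (rule distributed_integral[OF N, symmetric]) auto
  also have "\<dots> = - std_normal_density z"
    using std_normal_partial_expectation[of z] by (simp add: set_lebesgue_integral_def mult_ac)
  finally have N_A: "(LINT \<omega>:A|M. N \<omega>) = - std_normal_density z" .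
  have "(LINT \<omega>:A|M. a + b * N \<omega>) = (LINT \<omega>|M. a * indicator A \<omega> + b * (indicator A \<omega> * N \<omega>))"
    unfolding set_lebesgue_integral_def by (simp add: algebra_simps)
  also have "\<dots> = a * p + b * (LINT \<omega>:A|M. N \<omega>)"
    using integrable_real_mult_indicator[OF \<open>A \<in> sets M\<close> int_N] prob_A
    by (subst Bochner_Integration.integral_add)
       (auto simp: set_lebesgue_integral_def mult.commute less_top[symmetric])
  finally have "(LINT \<omega>:A|M. a + b * N \<omega>) / prob A = a - b * std_normal_density z / p"
    using \<open>0 < p\<close> by (simp add: prob_A N_A field_simps)
  moreover have "{\<omega> \<in> space M. a + b * N \<omega> < VaR M p (\<lambda>\<omega>. a + b * N \<omega>)} = A"
    using \<open>0 < b\<close> by (auto simp: VaR_affine_std_normal[OF assms] A_def z_def)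
  ultimately show ?thesis
    using prob_A \<open>0 < p\<close> by (simp add: CLVaR_def cond_expectation_on_def z_def Let_def)
qed

end

text \<open>Covers the zero portfolio. Nothing lies below the quantile of a constant, so the
  conditioning event is empty and the default value of \<open>CLVaR\<close> applies.\<close>

lemma CLVaR_const:
  assumes "0 < p" "p < 1"
  shows "CLVaR M p (\<lambda>_. c) = c"
proof -
  have "cdf (distr M borel (\<lambda>_. c)) x = indicator {c..} x" for x
  proof -
    have "cdf (distr M borel (\<lambda>_. c)) x = prob ((\<lambda>_. c) -` {..x} \<inter> space M)"
      unfolding cdf_def by (rule measure_distr) auto
    then show ?thesis by (auto simp: indicator_def prob_space)
  qed
  then have "{x. p \<le> cdf (distr M borel (\<lambda>_. c)) x} = {c..}"
    using assms by (auto simp: indicator_def split: if_splits)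
  then have "VaR M p (\<lambda>_. c) = c" by (simp add: VaR_def)
  then show ?thesis by (simp add: CLVaR_def Let_def)
qed

end

section \<open>Moments of Gaussian variables and of Brownian motion\<close>

text \<open>A positive second moment excludes the almost surely constant alternative of
  \<open>gaussian_rv\<close>, since a centered constant is 0. In the other alternative the standard
  deviation is the parameter \<open>s\<close> of the density.\<close>

lemma gaussian_rv_standardized:
  assumes "prob_space M" and X: "gaussian_rv M X"
    and mean: "integral\<^sup>L M X = 0" and var: "integral\<^sup>L M (\<lambda>\<omega>. (X \<omega>)\<^sup>2) > 0"
  shows "distributed M lborel (\<lambda>\<omega>. X \<omega> / std_deviation M X) std_normal_density"
proof -
  interpret prob_space M by fact
  have meas[measurable]: "X \<in> borel_measurable M"
    using X by (simp add: gaussian_rv_def)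
  consider m s where "s > 0" "distributed M lborel X (\<lambda>x. ennreal (normal_density m s x))"
    | m where "AE \<omega> in M. X \<omega> = m"
    using X by (auto simp: gaussian_rv_def)
  then show ?thesis
  proof cases
    case 1
    have "m = 0"
      using normal_distributed_expectation[OF 1] mean by simp
    moreover have "std_deviation M X = s"
      using normal_distributed_variance[OF 1] \<open>s > 0\<close> mean
      by (simp add: std_deviation_def covariance_def power2_eq_square)
    ultimately show ?thesis
      using normal_standard_normal_convert[OF \<open>s > 0\<close>, of X m] 1(2) by simp
  next
    case 2
    have "integral\<^sup>L M X = integral\<^sup>L M (\<lambda>_. m)"
      using 2 by (intro integral_cong_AE) auto
    then have "m = 0" using mean by (simp add: prob_space)
    have "integral\<^sup>L M (\<lambda>\<omega>. (X \<omega>)\<^sup>2) = integral\<^sup>L M (\<lambda>_. 0)"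
      using 2 \<open>m = 0\<close> by (intro integral_cong_AE) auto
    then show ?thesis using var by simp
  qed
qed

lemma integrable_mult_of_square_integrable:
  fixes f g :: "'a \<Rightarrow> real"
  assumes "f \<in> borel_measurable M" "g \<in> borel_measurable M"
    and "integrable M (\<lambda>x. (f x)\<^sup>2)" "integrable M (\<lambda>x. (g x)\<^sup>2)"
  shows "integrable M (\<lambda>x. f x * g x)"
proof (rule Bochner_Integration.integrable_bound)
  show "integrable M (\<lambda>x. (f x)\<^sup>2 + (g x)\<^sup>2)" using assms by simp
  have "\<bar>a * b\<bar> \<le> a\<^sup>2 + b\<^sup>2" for a b :: real
    using sum_squares_bound[of "\<bar>a\<bar>" "\<bar>b\<bar>"] abs_ge_zero[of "a * b"]
    unfolding abs_mult power2_abs by linarith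
  then show "AE x in M. norm (f x * g x) \<le> norm ((f x)\<^sup>2 + (g x)\<^sup>2)" by simp
qed (use assms in measurable)

text \<open>The definition gives laws of increments. For \<open>t > 0\<close> the value
  \<open>B t\<close> is almost surely the increment from time 0 and inherits its moments; at time 0
  it is almost surely 0.\<close>

lemma standard_brownian_motion_moments:
  assumes "prob_space M" "standard_brownian_motion M B" "0 \<le> t"
  shows "B t \<in> borel_measurable M"
    and "integrable M (B t)"
    and "integrable M (\<lambda>\<omega>. (B t \<omega>)\<^sup>2)"
    and "integral\<^sup>L M (B t) = 0"
proof -
  interpret prob_space M by fact
  have meas: "B s \<in> borel_measurable M" if "0 \<le> s" for s
    using assms(2) that by (auto simp: standard_brownian_motion_def)
  note [measurable] = meas[OF order_refl] meas[OF \<open>0 \<le> t\<close>]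
  have B0: "AE \<omega> in M. B 0 \<omega> = 0"
    using assms(2) by (auto simp: standard_brownian_motion_def)
  show "B t \<in> borel_measurable M" by measurable
  have "integrable M (B t) \<and> integrable M (\<lambda>\<omega>. (B t \<omega>)\<^sup>2) \<and> integral\<^sup>L M (B t) = 0"
  proof (cases "t = 0")
    case True
    have "integrable M (B 0) \<longleftrightarrow> integrable M (\<lambda>_. 0 :: real)"
      using B0 by (intro integrable_cong_AE) auto
    moreover have "integrable M (\<lambda>\<omega>. (B 0 \<omega>)\<^sup>2) \<longleftrightarrow> integrable M (\<lambda>_. 0 :: real)"
      using B0 by (intro integrable_cong_AE) auto
    moreover have "integral\<^sup>L M (B 0) = integral\<^sup>L M (\<lambda>_. 0 :: real)"
      using B0 by (intro integral_cong_AE) auto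
    ultimately show ?thesis using True by simp
  next
    case False
    define D where "D \<omega> = B t \<omega> - B 0 \<omega>" for \<omega>
    have D: "distributed M lborel D (\<lambda>x. ennreal (normal_density 0 (sqrt t) x))"
    proof -
      have "0 \<le> (0::real) \<and> 0 < t" using \<open>0 \<le> t\<close> False by simp
      then have "distributed M lborel (\<lambda>\<omega>. B t \<omega> - B 0 \<omega>)
          (\<lambda>x. ennreal (normal_density 0 (sqrt (t - 0)) x))"
        using assms(2) unfolding standard_brownian_motion_def by blast
      then show ?thesis unfolding D_def by simp
    qed
    have [measurable]: "D \<in> borel_measurable M" unfolding D_def by measurable
    have pos: "0 < sqrt t" using \<open>0 \<le> t\<close> False by simp
    have BD: "AE \<omega> in M. B t \<omega> = D \<omega>"
      using B0 by eventually_elim (simp add: D_def)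
    have "integrable M D"
      using distributed_integrable[OF D, of "\<lambda>x. x"] integrable_normal_moment[OF pos, of 0 1] by simp
    moreover have "integrable M (\<lambda>\<omega>. (D \<omega>)\<^sup>2)"
      using distributed_integrable[OF D, of "\<lambda>x. x\<^sup>2"] integrable_normal_moment[OF pos, of 0 2] by simp
    moreover have "integral\<^sup>L M D = 0"
      by (rule normal_distributed_expectation[OF pos D])
    moreover have "integrable M (B t) \<longleftrightarrow> integrable M D"
      using BD by (intro integrable_cong_AE) auto
    moreover have "integrable M (\<lambda>\<omega>. (B t \<omega>)\<^sup>2) \<longleftrightarrow> integrable M (\<lambda>\<omega>. (D \<omega>)\<^sup>2)"
      using BD by (intro integrable_cong_AE) auto
    moreover have "integral\<^sup>L M (B t) = integral\<^sup>L M D"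
      using BD by (intro integral_cong_AE) auto
    ultimately show ?thesis by simp
  qed
  then show "integrable M (B t)" "integrable M (\<lambda>\<omega>. (B t \<omega>)\<^sup>2)" "integral\<^sup>L M (B t) = 0"
    by auto
qed

section \<open>Correlated Brownian motions and the law of the weighted sum Lambda\<close>

locale correlated_brownian_motions = prob_space M for M :: "'a measure" +
  fixes B :: "'m::finite \<Rightarrow> real \<Rightarrow> 'a \<Rightarrow> real" and \<rho> :: "'m \<Rightarrow> 'm \<Rightarrow> real" and \<sigma> :: "'m \<Rightarrow> real"
  assumes brownian: "\<And>j. standard_brownian_motion M (B j)"
    and gaussian: "jointly_gaussian M (UNIV \<times> {0..}) (\<lambda>(j, t). B j t)"
    and cov: "\<And>i j s t. 0 \<le> s \<Longrightarrow> 0 \<le> t \<Longrightarrow> covariance M (B i t) (B j (t + s)) = t * \<rho> i j"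
begin

abbreviation \<Sigma> :: "real^'m^'m" where "\<Sigma> \<equiv> vol_cov_matrix \<sigma> \<rho>"

text \<open>\<open>mix_process\<close> divides this sum by the quadratic form and
  \<open>V_rv\<close> multiplies it back; working with the undivided sum avoids the
  quotient.\<close>

definition portfolio_noise :: "real^'m \<Rightarrow> real \<Rightarrow> 'a \<Rightarrow> real" where
  "portfolio_noise x t \<omega> = (\<Sum>j\<in>UNIV. x $ j * \<sigma> j * B j t \<omega>)"

lemma
  assumes "0 \<le> t"
  shows B_measurable: "B j t \<in> borel_measurable M"
    and B_integrable: "integrable M (B j t)"
    and B_square_integrable: "integrable M (\<lambda>\<omega>. (B j t \<omega>)\<^sup>2)"
    and B_mean: "expectation (B j t) = 0"
  using standard_brownian_motion_moments[OF prob_space_axioms brownian assms] by auto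

lemma B_mult_integrable:
  assumes "0 \<le> s" "0 \<le> t"
  shows "integrable M (\<lambda>\<omega>. B i s \<omega> * B j t \<omega>)"
  using assms by (intro integrable_mult_of_square_integrable B_measurable B_square_integrable)

lemma rho_sym: "\<rho> i j = \<rho> j i"
  using cov[of 0 1 i j] cov[of 0 1 j i] by (simp add: covariance_def mult.commute)

lemma vol_cov_matrix_sym: "transpose \<Sigma> = \<Sigma>"
  by (auto simp: vec_eq_iff transpose_def vol_cov_matrix_def rho_sym)

text \<open>The covariance assumption only covers a second time at least as late as the first;
  symmetry of \<open>\<rho>\<close> supplies the other order.\<close>

lemma expectation_B_mult:
  assumes "0 \<le> s" "0 \<le> t"
  shows "expectation (\<lambda>\<omega>. B i s \<omega> * B j t \<omega>) = min s t * \<rho> i j"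
proof (cases "s \<le> t")
  case True
  then show ?thesis using cov[of "t - s" s i j] assms by (simp add: covariance_def B_mean)
next
  case False
  then show ?thesis using cov[of "s - t" t j i] assms
    by (simp add: covariance_def B_mean rho_sym[of i j] mult.commute)
qed

lemma
  assumes "0 \<le> t"
  shows portfolio_noise_integrable: "integrable M (portfolio_noise x t)"
    and portfolio_noise_mean: "expectation (portfolio_noise x t) = 0"
proof -
  have *: "portfolio_noise x t = (\<lambda>\<omega>. \<Sum>j\<in>UNIV. x $ j * \<sigma> j * B j t \<omega>)"
    by (simp add: portfolio_noise_def fun_eq_iff)
  show "integrable M (portfolio_noise x t)"
    unfolding * using assms by (auto intro!: Bochner_Integration.integrable_sum B_integrable)
  show "expectation (portfolio_noise x t) = 0"
    unfolding * using assms by (simp add: Bochner_Integration.integral_sum B_integrable B_mean)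
qed

lemma
  assumes "0 \<le> s" "0 \<le> t"
  shows portfolio_noise_mult_integrable:
      "integrable M (\<lambda>\<omega>. portfolio_noise x s \<omega> * portfolio_noise x t \<omega>)"
    and expectation_portfolio_noise_mult:
      "expectation (\<lambda>\<omega>. portfolio_noise x s \<omega> * portfolio_noise x t \<omega>) = min s t * quad_form \<Sigma> x"
proof -
  have *: "(\<lambda>\<omega>. portfolio_noise x s \<omega> * portfolio_noise x t \<omega>) =
      (\<lambda>\<omega>. \<Sum>i\<in>UNIV. \<Sum>j\<in>UNIV. (x $ i * \<sigma> i * x $ j * \<sigma> j) * (B i s \<omega> * B j t \<omega>))"
    unfolding portfolio_noise_def sum_product by (intro ext sum.cong refl) (simp only: mult_ac)
  show "integrable M (\<lambda>\<omega>. portfolio_noise x s \<omega> * portfolio_noise x t \<omega>)"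
    unfolding * using assms by (auto intro!: B_mult_integrable Bochner_Integration.integrable_sum)
  have "expectation (\<lambda>\<omega>. portfolio_noise x s \<omega> * portfolio_noise x t \<omega>) =
      (\<Sum>i\<in>UNIV. \<Sum>j\<in>UNIV. (x $ i * \<sigma> i * x $ j * \<sigma> j) * (min s t * \<rho> i j))"
    unfolding * using assms
    by (simp add: Bochner_Integration.integral_sum B_mult_integrable expectation_B_mult)
  also have "\<dots> = min s t * quad_form \<Sigma> x"
    unfolding quad_form_def inner_vec_def matrix_vector_mult_def vol_cov_matrix_def sum_distrib_left
    by (auto intro!: sum.cong simp: sum_distrib_left)
  finally show "expectation (\<lambda>\<omega>. portfolio_noise x s \<omega> * portfolio_noise x t \<omega>) =
      min s t * quad_form \<Sigma> x" .
qed

text \<open>The quadratic form at \<open>x\<close> is the second moment of the portfolio noise at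
  time 1.\<close>

lemma quad_form_nonneg: "0 \<le> quad_form \<Sigma> x"
proof -
  have "0 \<le> expectation (\<lambda>\<omega>. portfolio_noise x 1 \<omega> * portfolio_noise x 1 \<omega>)"
    by (rule Bochner_Integration.integral_nonneg) simp
  then show ?thesis by (simp add: expectation_portfolio_noise_mult)
qed

lemma Lambda_rv_eq:
  assumes "quad_form \<Sigma> x \<noteq> 0"
  shows "Lambda_rv \<Sigma> \<sigma> B \<tau> \<alpha> x \<omega> =
    (\<Sum>t<\<tau>. \<alpha> t * (portfolio_noise x (real \<tau>) \<omega> - portfolio_noise x (real t) \<omega>))"
proof -
  have "c * (1 / c * a - 1 / c * b) = a - b" if "c \<noteq> 0" for a b c :: real
    using that by (simp add: field_simps)
  then show ?thesis
    using assms unfolding Lambda_rv_def V_rv_def mix_process_def portfolio_noise_def by simp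
qed

lemma Lambda_rv_gaussian:
  assumes "quad_form \<Sigma> x \<noteq> 0"
  shows "gaussian_rv M (Lambda_rv \<Sigma> \<sigma> B \<tau> \<alpha> x)"
proof -
  \<comment> \<open>The terminal noise occurs in every summand of Lambda, so date
    \<open>\<tau>\<close> collects all endowments, while an earlier date keeps
    \<open>- \<alpha> t\<close>.\<close>
  define w where "w t = (if t = \<tau> then \<Sum>k<\<tau>. \<alpha> k else - \<alpha> t)" for t
  \<comment> \<open>Joint Gaussianity is indexed by real times; the floor recovers the integer date
    of a time in \<open>F\<close>.\<close>
  define c :: "'m \<times> real \<Rightarrow> real" where "c = (\<lambda>(j, s). x $ j * \<sigma> j * w (nat \<lfloor>s\<rfloor>))"
  define F :: "('m \<times> real) set" where "F = UNIV \<times> real ` {..\<tau>}"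
  have "Lambda_rv \<Sigma> \<sigma> B \<tau> \<alpha> x \<omega> = (\<Sum>i\<in>F. c i * (case i of (j, t) \<Rightarrow> B j t) \<omega>)" for \<omega>
  proof -
    have "Lambda_rv \<Sigma> \<sigma> B \<tau> \<alpha> x \<omega> = (\<Sum>t\<le>\<tau>. w t * portfolio_noise x (real t) \<omega>)"
      unfolding Lambda_rv_eq[OF assms]
      by (simp add: w_def lessThan_Suc_atMost[symmetric] right_diff_distrib sum_subtractf
          sum_distrib_right sum_negf)
    also have "\<dots> = (\<Sum>j\<in>UNIV. \<Sum>t\<le>\<tau>. x $ j * \<sigma> j * w t * B j (real t) \<omega>)"
      unfolding portfolio_noise_def sum_distrib_left by (subst sum.swap) (simp add: mult_ac)
    also have "\<dots> = (\<Sum>j\<in>UNIV. \<Sum>s\<in>real ` {..\<tau>}. c (j, s) * B j s \<omega>)"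
      by (subst sum.reindex) (auto simp: c_def)
    also have "\<dots> = (\<Sum>i\<in>F. c i * (case i of (j, t) \<Rightarrow> B j t) \<omega>)"
      unfolding F_def by (subst sum.cartesian_product) (auto simp: case_prod_unfold)
    finally show ?thesis .
  qed
  then have *: "Lambda_rv \<Sigma> \<sigma> B \<tau> \<alpha> x = (\<lambda>\<omega>. \<Sum>i\<in>F. c i * (case i of (j, t) \<Rightarrow> B j t) \<omega>)"
    by (rule ext)
  have "finite F" "F \<subseteq> UNIV \<times> {0..}"
    by (auto simp: F_def)
  then show ?thesis
    unfolding * using gaussian by (simp add: jointly_gaussian_def)
qed

lemma Lambda_rv_mean:
  assumes "quad_form \<Sigma> x \<noteq> 0"
  shows "expectation (Lambda_rv \<Sigma> \<sigma> B \<tau> \<alpha> x) = 0"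
  unfolding Lambda_rv_eq[OF assms, abs_def]
  by (simp add: Bochner_Integration.integral_sum portfolio_noise_integrable portfolio_noise_mean)

text \<open>Noise increments over \<open>[k, \<tau>]\<close> and \<open>[l, \<tau>]\<close> have as
  covariance the length of the overlap times the quadratic form. Expanding the square of the sum
  yields the double sum.\<close>

lemma Lambda_rv_second_moment:
  assumes "quad_form \<Sigma> x \<noteq> 0"
  shows "expectation (\<lambda>\<omega>. (Lambda_rv \<Sigma> \<sigma> B \<tau> \<alpha> x \<omega>)\<^sup>2) =
    (\<Sum>k<\<tau>. \<Sum>l<\<tau>. \<alpha> k * \<alpha> l * min (real \<tau> - real k) (real \<tau> - real l)) * quad_form \<Sigma> x"
proof -
  let ?U = "\<lambda>t. portfolio_noise x (real t)"
  let ?f = "\<lambda>k l \<omega>. (?U \<tau> \<omega> - ?U k \<omega>) * (?U \<tau> \<omega> - ?U l \<omega>)"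
  have f: "?f k l = (\<lambda>\<omega>. ?U \<tau> \<omega> * ?U \<tau> \<omega> - ?U \<tau> \<omega> * ?U l \<omega> - ?U k \<omega> * ?U \<tau> \<omega> + ?U k \<omega> * ?U l \<omega>)" for k l
    by (simp add: fun_eq_iff algebra_simps)
  have int: "integrable M (?f k l)" for k l
    unfolding f by (simp add: portfolio_noise_mult_integrable)
  have exp_f: "expectation (?f k l) = min (real \<tau> - real k) (real \<tau> - real l) * quad_form \<Sigma> x"
    if "k < \<tau>" "l < \<tau>" for k l
  proof -
    have "expectation (?f k l) = (real \<tau> - real l - real k + min (real k) (real l)) * quad_form \<Sigma> x"
      unfolding f using that
      by (simp add: portfolio_noise_mult_integrable expectation_portfolio_noise_mult
          min_absorb1 min_absorb2 left_diff_distrib distrib_right)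
    also have "real \<tau> - real l - real k + min (real k) (real l) = min (real \<tau> - real k) (real \<tau> - real l)"
      by (auto simp: min_def)
    finally show ?thesis .
  qed
  have "(\<lambda>\<omega>. (Lambda_rv \<Sigma> \<sigma> B \<tau> \<alpha> x \<omega>)\<^sup>2) = (\<lambda>\<omega>. \<Sum>k<\<tau>. \<Sum>l<\<tau>. (\<alpha> k * \<alpha> l) * ?f k l \<omega>)"
    unfolding Lambda_rv_eq[OF assms] power2_eq_square sum_product by (simp add: mult_ac)
  then show ?thesis
    by (simp add: Bochner_Integration.integral_sum Bochner_Integration.integrable_sum int exp_f
        sum_distrib_left mult_ac)
qed

end

lemma (in correlated_brownian_motions) normalized_Lambda_rv:
  assumes "quad_form \<Sigma> x \<noteq> 0"
    and "0 < (\<Sum>k<\<tau>. \<Sum>l<\<tau>. \<alpha> k * \<alpha> l * min (real \<tau> - real k) (real \<tau> - real l))"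
  shows "distributed M lborel
    (\<lambda>\<omega>. Lambda_rv \<Sigma> \<sigma> B \<tau> \<alpha> x \<omega> / std_deviation M (Lambda_rv \<Sigma> \<sigma> B \<tau> \<alpha> x)) std_normal_density"
proof (rule gaussian_rv_standardized)
  show "0 < expectation (\<lambda>\<omega>. (Lambda_rv \<Sigma> \<sigma> B \<tau> \<alpha> x \<omega>)\<^sup>2)"
    using assms quad_form_nonneg[of x] by (simp add: Lambda_rv_second_moment)
qed (use assms prob_space_axioms in \<open>simp_all add: Lambda_rv_gaussian Lambda_rv_mean\<close>)

section \<open>Positivity of the endowment constants\<close>

context
  fixes \<tau> :: nat and \<alpha> :: "nat \<Rightarrow> real"
  assumes nonneg: "\<forall>t<\<tau>. 0 \<le> \<alpha> t" and nonzero: "\<exists>t<\<tau>. \<alpha> t \<noteq> 0"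
begin

text \<open>Every summand is nonnegative and a date with nonzero endowment contributes strictly. All
  positivity claims about the constants reduce to this.\<close>

lemma endowment_sum_pos:
  assumes "\<And>t. t < \<tau> \<Longrightarrow> 0 < f t"
  shows "0 < (\<Sum>t<\<tau>. \<alpha> t * f t)"
proof -
  obtain t0 where "t0 < \<tau>" "\<alpha> t0 \<noteq> 0" using nonzero by blast
  then show ?thesis
    using nonneg assms
    by (intro sum_pos2[of _ t0]) (auto simp: less_le)
qed

lemma endowment_min_sum_pos:
  assumes "t < \<tau>"
  shows "0 < (\<Sum>l<\<tau>. \<alpha> l * min (real \<tau> - real t) (real \<tau> - real l))"
  using assms by (intro endowment_sum_pos) auto

text \<open>This factor of the second moment keeps the standard deviation of Lambda away from 0; it
  is an endowment sum of positive inner sums.\<close>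

lemma endowment_covariance_pos:
  "0 < (\<Sum>k<\<tau>. \<Sum>l<\<tau>. \<alpha> k * \<alpha> l * min (real \<tau> - real k) (real \<tau> - real l))"
  using endowment_sum_pos[OF endowment_min_sum_pos] by (simp add: sum_distrib_left mult.assoc)

lemma const6_pos: "0 < const6 \<tau> \<alpha>"
  unfolding const6_def by (intro endowment_sum_pos) simp

lemma const7_pos: "0 < const7 \<tau> \<alpha>"
  unfolding const7_def
  by (intro endowment_sum_pos divide_pos_pos zero_less_power endowment_min_sum_pos mult_pos_pos
      endowment_covariance_pos) auto

lemma const8_pos: "0 < const8 \<tau> \<alpha>"
  unfolding const8_def
  by (intro endowment_sum_pos divide_pos_pos endowment_min_sum_pos real_sqrt_gt_zero
      endowment_covariance_pos) auto

end

section \<open>Quadratic forms of symmetric matrices\<close>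

lemma inner_symmetric_matrix:
  fixes S :: "real^'m^'m"
  assumes "transpose S = S"
  shows "x \<bullet> (S *v y) = (S *v x) \<bullet> y"
  by (metis assms dot_lmul_matrix vector_transpose_matrix)

text \<open>Symmetry merges the two cross terms. When \<open>S *v z\<close> is the excess drift, the
  cross term depends on \<open>x\<close> only through its excess return.\<close>

lemma quad_form_diff:
  fixes S :: "real^'m^'m"
  assumes "transpose S = S"
  shows "quad_form S (x - u *\<^sub>R z) = quad_form S x - 2 * u * ((S *v z) \<bullet> x) + u\<^sup>2 * quad_form S z"
  unfolding quad_form_def using inner_symmetric_matrix[OF assms, of z x]
  by (simp add: matrix_vector_mult_diff_distrib matrix_vector_mult_scaleR inner_diff_left
      inner_diff_right inner_commute power2_eq_square algebra_simps)

lemma quad_form_scaleR: "quad_form S (u *\<^sub>R z) = u\<^sup>2 * quad_form S z"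
  by (simp add: quad_form_def matrix_vector_mult_scaleR power2_eq_square)

text \<open>If the form vanished at \<open>x\<close>, moving from \<open>x\<close> against
  \<open>z = S *v x\<close> would start with slope \<open>-2 * (z \<bullet> z)\<close> and make it
  negative, unless \<open>z = 0\<close>, which invertibility excludes.\<close>

lemma quad_form_pos:
  fixes S :: "real^'m^'m"
  assumes sym: "transpose S = S" and nonneg: "\<And>x. 0 \<le> quad_form S x"
    and "invertible S" and "x \<noteq> 0"
  shows "0 < quad_form S x"
proof (rule ccontr)
  assume "\<not> 0 < quad_form S x"
  then have Qx: "quad_form S x = 0" using nonneg[of x] by simp
  define z where "z = S *v x"
  have "z \<noteq> 0"
  proof
    assume "z = 0"
    obtain T where "T ** S = mat 1" using \<open>invertible S\<close> by (auto simp: invertible_def)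
    then have "x = T *v z" by (simp add: z_def matrix_vector_mul_assoc)
    then show False using \<open>z = 0\<close> \<open>x \<noteq> 0\<close> by simp
  qed
  then have n: "0 < z \<bullet> z" by simp
  have ineq: "0 \<le> - 2 * u * (z \<bullet> z) + u\<^sup>2 * quad_form S z" for u
    using nonneg[of "x - u *\<^sub>R z"] inner_symmetric_matrix[OF sym, of z x]
    by (simp add: quad_form_diff[OF sym] Qx z_def)
  show False
  proof (cases "quad_form S z = 0")
    case True
    then show False using ineq[of 1] n by simp
  next
    case False
    then have "0 < quad_form S z" using nonneg[of z] by simp
    \<comment> \<open>The chosen \<open>u\<close> minimizes the quadratic in
      \<open>ineq\<close>.\<close>
    moreover have "0 \<le> - ((z \<bullet> z)\<^sup>2 / quad_form S z)"
      using ineq[of "(z \<bullet> z) / quad_form S z"] False by (simp add: power2_eq_square field_simps)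
    ultimately show False using n by (simp add: divide_le_0_iff)
  qed
qed

lemma matrix_inv_right:
  fixes S :: "real^'m^'m"
  assumes "invertible S"
  shows "S ** matrix_inv S = mat 1"
  using someI_ex[of "\<lambda>T. S ** T = mat 1 \<and> T ** S = mat 1"] assms
  unfolding invertible_def matrix_inv_def by blast

section \<open>The optimization along a single direction\<close>

text \<open>
  The parabola \<open>P v = B1 * v\<^sup>2 + B2 * v + B3\<close>, whose larger root is \<open>q1\<close>, agrees with the constraint
  function \<open>F\<close> only for \<open>v \<ge> 0\<close>, where \<open>\<bar>v\<bar> = v\<close>; for \<open>v < 0\<close> it lies above \<open>F\<close>. So \<open>0 \<le> F u\<close> still
  forces \<open>u \<le> q1\<close> and makes the discriminant nonnegative. The value \<open>q2\<close> never lies below the smaller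
  root of \<open>P\<close>, since it is at least the abscissa of the vertex.
\<close>

lemma scalar_mean_variance_optimum:
  fixes A c6 c7 c9 B3 q3 u :: real
  defines "B1 \<equiv> - c7 * A" and "B2 \<equiv> c6 * A - c9 * sqrt A"
  defines "q1 \<equiv> (- B2 - sqrt (B2\<^sup>2 - 4 * B1 * B3)) / (2 * B1)" and "q2 \<equiv> c6 / (2 * c7)"
  defines "q \<equiv> Min {q1, q2, q3}"
  defines "F \<equiv> \<lambda>v. B3 + c6 * (v * A) - c7 * (v\<^sup>2 * A) - c9 * (\<bar>v\<bar> * sqrt A)"
  assumes "0 < A" "0 < c6" "0 < c7" "0 \<le> c9" and Fu: "0 \<le> F u" and uq3: "u \<le> q3"
  shows "0 \<le> F q" and "q \<le> q3"
    and "u \<noteq> q \<Longrightarrow> c6 * (u * A) - c7 * (u\<^sup>2 * A) < c6 * (q * A) - c7 * (q\<^sup>2 * A)"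
proof -
  define D where "D = B2\<^sup>2 - 4 * B1 * B3"
  define P where "P v = B1 * v\<^sup>2 + B2 * v + B3" for v
  have B1: "B1 < 0" using assms(6-) by (simp add: B1_def)
  have "0 < q2" using assms(6-) by (simp add: q2_def)
  have FP: "F v = P v + c9 * sqrt A * (v - \<bar>v\<bar>)" for v
    by (simp add: F_def P_def B1_def B2_def algebra_simps)
  \<comment> \<open>Completing the square: \<open>2 * B1 * v + B2\<close> is the slope of
    \<open>P\<close> at \<open>v\<close>, so \<open>0 \<le> P v\<close> becomes a bound on that
    slope.\<close>
  have square: "4 * B1 * P v = (2 * B1 * v + B2)\<^sup>2 - D" for v
    by (simp add: P_def D_def power2_eq_square algebra_simps)
  have P_iff: "0 \<le> P v \<longleftrightarrow> \<bar>2 * B1 * v + B2\<bar> \<le> sqrt D" for v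
  proof -
    have "0 \<le> P v \<longleftrightarrow> 4 * B1 * P v \<le> 0" using B1 by (auto simp: mult_le_0_iff)
    also have "\<dots> \<longleftrightarrow> (2 * B1 * v + B2)\<^sup>2 \<le> D" by (simp add: square)
    \<comment> \<open>The real \<open>sqrt\<close> is increasing on the whole line and negative at
      negative arguments, so no sign of \<open>D\<close> has to be assumed.\<close>
    also have "\<dots> \<longleftrightarrow> \<bar>2 * B1 * v + B2\<bar> \<le> sqrt D"
      using real_sqrt_le_iff[of "(2 * B1 * v + B2)\<^sup>2" D] by simp
    finally show ?thesis .
  qed
  have "c9 * sqrt A * (u - \<bar>u\<bar>) \<le> 0"
    using assms(6-) by (intro mult_nonneg_nonpos) auto
  then have "0 \<le> P u" using Fu FP[of u] by linarith
  then have u: "\<bar>2 * B1 * u + B2\<bar> \<le> sqrt D" by (simp add: P_iff)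
  have q1: "2 * B1 * q1 + B2 = - sqrt D" using B1 by (simp add: q1_def D_def)
  have "u \<le> q1"
  proof -
    have "2 * B1 * q1 \<le> 2 * B1 * u" using u q1 by linarith
    then show ?thesis using B1 by simp
  qed
  have q_cases: "q = q1 \<or> q = q2 \<or> q = q3" and q_le: "q \<le> q1" "q \<le> q2" "q \<le> q3"
    by (auto simp: q_def min_def)
  show "q \<le> q3" by fact
  \<comment> \<open>Below \<open>q2\<close> the minimum is \<open>q1\<close> or \<open>q3\<close>,
    and both bound \<open>u\<close> from above.\<close>
  have u_le_q: "u \<le> q" if "q < q2"
    using q_cases that \<open>u \<le> q1\<close> uq3 by auto
  have Pq: "0 \<le> P q"
    unfolding P_iff
  proof (rule abs_leI)
    have "2 * B1 * q1 \<le> 2 * B1 * q" using q_le(1) B1 by simp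
    then show "- (2 * B1 * q + B2) \<le> sqrt D" using q1 by linarith
    show "2 * B1 * q + B2 \<le> sqrt D"
    proof (cases "q < q2")
      case True
      then have "2 * B1 * q \<le> 2 * B1 * u" using u_le_q B1 by simp
      then show ?thesis using u by linarith
    next
      case False
      then have "q = q2" using q_le by simp
      \<comment> \<open>\<open>q2\<close> is the maximizer of the objective alone, so only the tail
        term is left in the slope.\<close>
      then have "2 * B1 * q + B2 = - (c9 * sqrt A)"
        using \<open>0 < c7\<close> by (simp add: q2_def B1_def B2_def)
      moreover have "0 \<le> c9 * sqrt A" using assms(6-) by simp
      ultimately show ?thesis using u by linarith
    qed
  qed
  show "0 \<le> F q"
  proof (cases "0 \<le> q")
    case True
    then show ?thesis using Pq FP[of q] by simp
  next
    case False
    \<comment> \<open>Now \<open>u \<le> q < 0\<close>: moving from \<open>u\<close> up to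
      \<open>q\<close> approaches 0, and no term of \<open>F\<close> decreases.\<close>
    then have "u \<le> q" using u_le_q \<open>0 < q2\<close> by simp
    then have "q\<^sup>2 \<le> u\<^sup>2" using False by (simp add: abs_le_square_iff[symmetric])
    then have "c7 * (q\<^sup>2 * A) \<le> c7 * (u\<^sup>2 * A)" "c6 * (u * A) \<le> c6 * (q * A)"
      "c9 * (\<bar>q\<bar> * sqrt A) \<le> c9 * (\<bar>u\<bar> * sqrt A)"
      using assms(6-) \<open>u \<le> q\<close> False by (auto intro!: mult_left_mono mult_right_mono)
    then show ?thesis using Fu unfolding F_def by linarith
  qed
  assume "u \<noteq> q"
  have c6: "c6 = 2 * c7 * q2" using \<open>0 < c7\<close> by (simp add: q2_def)
  \<comment> \<open>The product is the difference of the squared distances of \<open>u\<close> and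
    \<open>q\<close> from the axis \<open>q2\<close>; times \<open>c7 * A\<close> it is the gain in
    the objective.\<close>
  have "0 < (q - u) * (2 * q2 - (q + u))"
  proof (cases "u < q")
    case True
    then show ?thesis using q_le by (intro mult_pos_pos) auto
  next
    case False
    then have "q = q2" "q < u" using u_le_q q_le \<open>u \<noteq> q\<close> by fastforce+
    then show ?thesis by (intro mult_neg_neg) auto
  qed
  then have "0 < (c7 * A) * ((q - u) * (2 * q2 - (q + u)))" using assms(6-) by simp
  also have "\<dots> = (c6 * (q * A) - c7 * (q\<^sup>2 * A)) - (c6 * (u * A) - c7 * (u\<^sup>2 * A))"
    by (simp add: c6 power2_eq_square algebra_simps)
  finally show "c6 * (u * A) - c7 * (u\<^sup>2 * A) < c6 * (q * A) - c7 * (q\<^sup>2 * A)" by simp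
qed

section \<open>Reduction of the portfolio problem to multiples of \<open>xstar\<close>\<close>

theorem proposition2p5:
  fixes M :: "'a measure"
    and \<tau> :: nat and \<alpha> :: "nat \<Rightarrow> real"
    and r p K c0 lam0 :: real
    and \<sigma> \<mu> lam :: "'m::finite \<Rightarrow> real" and \<rho> :: "'m \<Rightarrow> 'm \<Rightarrow> real"
    and B' :: "'m \<Rightarrow> real \<Rightarrow> 'a \<Rightarrow> real"
    and Z :: "nat \<Rightarrow> 'm \<Rightarrow> nat \<Rightarrow> 'a \<Rightarrow> real" and h :: "'m \<Rightarrow> nat \<Rightarrow> real"
    and y :: "real^'m"
    and \<Sigma> :: "real^'m^'m" and excess xstar :: "real^'m"
    and c5 c6 c7 c8 c9 B1 B2 B3 q1 q2 q3 q :: real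
    and W :: "real^'m \<Rightarrow> 'a \<Rightarrow> real" and feasible :: "real^'m \<Rightarrow> bool"
  assumes "prob_space M"
    and "0 < p" and "p < 1/2"
    and "0 < \<tau>" and "\<forall>t<\<tau>. 0 \<le> \<alpha> t" and "\<exists>t<\<tau>. \<alpha> t \<noteq> 0"
    and "0 < r"
    and "\<forall>j. 0 < \<sigma> j"
    and "\<forall>j. standard_brownian_motion M (B' j)"
    and "jointly_gaussian M (UNIV \<times> {0..}) (\<lambda>(j, t). B' j t)"
    and "\<forall>i j s t. 0 \<le> s \<and> 0 \<le> t \<longrightarrow> covariance M (B' i t) (B' j (t + s)) = t * \<rho> i j"
    and \<Sigma>_def: "\<Sigma> = vol_cov_matrix \<sigma> \<rho>" and "invertible \<Sigma>"
    and "0 \<le> lam0" and "\<forall>j. 0 \<le> lam j"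
    and "\<forall>k\<ge>1. \<forall>j. \<forall>l\<in>{0,1}. Z k j l \<in> borel_measurable M \<and> integrable M (\<lambda>\<omega>. exp (Z k j l \<omega>))
           \<and> h j l = integral\<^sup>L M (\<lambda>\<omega>. exp (Z k j l \<omega>)) - 1"
    and "\<forall>k\<ge>1. \<forall>j. \<forall>l\<in>{0,1}. AE \<omega> in M. 1 + y $ j * (exp (Z k j l \<omega>) - 1) > 0"
    and excess_def: "excess = drift_vector r \<mu> lam0 lam h - r *\<^sub>R 1"
    and c5_def: "c5 = const5 M Z y r lam0 lam \<tau> \<alpha>"
    and c6_def: "c6 = const6 \<tau> \<alpha>"
    and c7_def: "c7 = const7 \<tau> \<alpha>"
    and c8_def: "c8 = const8 \<tau> \<alpha>"
    and c9_def: "c9 = const9 \<tau> \<alpha> p"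
    and W_def: "W = (\<lambda>x \<omega>. c5 + c6 * (excess \<bullet> x) - c7 * quad_form \<Sigma> x
           + c8 * (Lambda_rv \<Sigma> \<sigma> B' \<tau> \<alpha> x \<omega> / std_deviation M (Lambda_rv \<Sigma> \<sigma> B' \<tau> \<alpha> x))
             * sqrt (quad_form \<Sigma> x))"
    and feasible_def: "feasible = (\<lambda>x. CLVaR M p (W x) \<ge> K \<and> excess \<bullet> x + r \<le> c0)"
    and xstar_def: "xstar = matrix_inv \<Sigma> *v excess"
    and B1_def: "B1 = - c7 * (excess \<bullet> (matrix_inv \<Sigma> *v excess))"
    and B2_def: "B2 = c6 / (- c7) * B1 - c9 * sqrt (B1 / (- c7))"
    and B3_def: "B3 = c5 - K"
    and q1_def: "q1 = (- B2 - sqrt (B2\<^sup>2 - 4 * B1 * B3)) / (2 * B1)"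
    and q2_def: "q2 = c6 / (2 * c7)"
    and q3_def: "q3 = (c0 - r) / (excess \<bullet> (matrix_inv \<Sigma> *v excess))"
    and q_def: "q = Min {q1, q2, q3}"
  shows "(\<forall>x. is_arg_max (\<lambda>x. integral\<^sup>L M (W x)) feasible x \<longrightarrow> x = q *\<^sub>R xstar)
       \<and> ((\<exists>x. feasible x) \<longrightarrow> is_arg_max (\<lambda>x. integral\<^sup>L M (W x)) feasible (q *\<^sub>R xstar))"
proof -
  interpret C: correlated_brownian_motions M B' \<rho> \<sigma>
    using assms(1,9-11) by (simp add: correlated_brownian_motions_def correlated_brownian_motions_axioms_def)
  have "p < 1" using \<open>p < 1/2\<close> by simp
  define Q where "Q = quad_form \<Sigma>"
  define A where "A = excess \<bullet> xstar"
  note pos = const6_pos const7_pos const8_pos endowment_covariance_pos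
  have c6: "0 < c6" and c7: "0 < c7" and c8: "0 < c8"
    and T: "0 < (\<Sum>k<\<tau>. \<Sum>l<\<tau>. \<alpha> k * \<alpha> l * min (real \<tau> - real k) (real \<tau> - real l))"
    unfolding c6_def c7_def c8_def
    using pos[OF \<open>\<forall>t<\<tau>. 0 \<le> \<alpha> t\<close> \<open>\<exists>t<\<tau>. \<alpha> t \<noteq> 0\<close>] by auto
  \<comment> \<open>With \<open>b = c8 * sqrt (Q x)\<close>, the tail correction of an affine normal
    variable is thus \<open>c9 * sqrt (Q x)\<close>.\<close>
  have c9_eq: "c9 = c8 * std_normal_density (std_normal_quantile p) / p"
    unfolding c9_def const9_def c8_def std_normal_density_def by simp
  then have c9: "0 \<le> c9" using c8 \<open>0 < p\<close> by simp
  have sym: "transpose \<Sigma> = \<Sigma>" unfolding \<Sigma>_def by (rule C.vol_cov_matrix_sym)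
  have Q_nonneg: "0 \<le> Q x" for x unfolding Q_def \<Sigma>_def by (rule C.quad_form_nonneg)
  have Q_pos: "0 < Q x" if "x \<noteq> 0" for x
    unfolding Q_def using sym Q_nonneg \<open>invertible \<Sigma>\<close> that by (intro quad_form_pos) (auto simp: Q_def)
  have Q0: "Q 0 = 0" by (simp add: Q_def quad_form_def)
  have xstar: "\<Sigma> *v xstar = excess"
    unfolding xstar_def using matrix_inv_right[OF \<open>invertible \<Sigma>\<close>] by (simp add: matrix_vector_mul_assoc)
  have Q_xstar: "Q xstar = A" unfolding Q_def quad_form_def xstar A_def by (rule inner_commute)

  \<comment> \<open>At \<open>0\<close> the normalized Lambda is not standard normal, but its factor
    \<open>sqrt (quad_form \<Sigma> 0)\<close> vanishes.\<close>
  have W0: "W 0 = (\<lambda>_. c5)" by (simp add: W_def Q0[unfolded Q_def])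
  have W: "integral\<^sup>L M (W x) = c5 + c6 * (excess \<bullet> x) - c7 * Q x \<and>
      CLVaR M p (W x) = c5 + c6 * (excess \<bullet> x) - c7 * Q x - c9 * sqrt (Q x)" for x
  proof (cases "x = 0")
    case True
    then show ?thesis
      using C.CLVaR_const[OF \<open>0 < p\<close> \<open>p < 1\<close>] by (simp add: W0 Q0 C.prob_space)
  next
    case False
    define N where
      "N \<omega> = Lambda_rv \<Sigma> \<sigma> B' \<tau> \<alpha> x \<omega> / std_deviation M (Lambda_rv \<Sigma> \<sigma> B' \<tau> \<alpha> x)" for \<omega>
    define a where "a = c5 + c6 * (excess \<bullet> x) - c7 * Q x"
    define b where "b = c8 * sqrt (Q x)"
    have "0 < b" using Q_pos[OF False] c8 by (simp add: b_def)
    have N: "distributed M lborel N std_normal_density"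
      using C.normalized_Lambda_rv[OF _ T, of x] Q_pos[OF False]
      unfolding N_def[abs_def] Q_def \<Sigma>_def by simp
    have Wx: "W x = (\<lambda>\<omega>. a + b * N \<omega>)"
      by (simp add: W_def a_def b_def N_def Q_def fun_eq_iff)
    have "integrable M N"
      using distributed_integrable_var[OF N] integrable_std_normal_moment[of 1] by simp
    then have "integral\<^sup>L M (W x) = a"
      using C.standard_normal_distributed_expectation[OF N] by (simp add: Wx C.prob_space)
    moreover have "CLVaR M p (W x) = a - c9 * sqrt (Q x)"
      unfolding Wx C.CLVaR_affine_std_normal[OF N \<open>0 < b\<close> \<open>0 < p\<close> \<open>p < 1\<close>] by (simp add: c9_eq b_def)
    ultimately show ?thesis by (simp add: a_def)
  qed
  then have mean: "integral\<^sup>L M (W x) = c5 + c6 * (excess \<bullet> x) - c7 * Q x"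
    and feasible_iff: "feasible x \<longleftrightarrow>
      0 \<le> B3 + c6 * (excess \<bullet> x) - c7 * Q x - c9 * sqrt (Q x) \<and> excess \<bullet> x + r \<le> c0" for x
    by (auto simp: feasible_def B3_def)

  have optimal: "feasible (q *\<^sub>R xstar) \<and>
      (x \<noteq> q *\<^sub>R xstar \<longrightarrow> integral\<^sup>L M (W x) < integral\<^sup>L M (W (q *\<^sub>R xstar)))"
    if x: "feasible x" for x
  \<comment> \<open>If \<open>excess = 0\<close>, the denominators of \<open>q1\<close> and
    \<open>q3\<close> vanish and both take the default value 0. Then \<open>xstar = 0\<close>, so
    the candidate is the zero portfolio, the only one without risk among portfolios of equal excess
    return.\<close>
  proof (cases "excess = 0")
    case True
    then have "xstar = 0" by (simp add: xstar_def)
    moreover have "0 \<le> c7 * Q x" "0 \<le> c9 * sqrt (Q x)" using Q_nonneg[of x] c7 c9 by auto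
    moreover have "0 < c7 * Q x" if "x \<noteq> 0" using Q_pos[OF that] c7 by simp
    ultimately show ?thesis
      using x True by (auto simp: feasible_iff mean Q0)
  next
    case False
    then have "xstar \<noteq> 0" using xstar by auto
    then have "0 < A" using Q_pos Q_xstar by auto
    \<comment> \<open>The coefficient of the projection of \<open>x\<close> onto
      \<open>xstar\<close> in the inner product given by \<open>\<Sigma>\<close>.\<close>
    define u where "u = (excess \<bullet> x) / A"
    have ux: "excess \<bullet> x = u * A" using \<open>0 < A\<close> by (simp add: u_def)
    have Qd: "Q (x - u *\<^sub>R xstar) = Q x - u\<^sup>2 * A"
      unfolding Q_def quad_form_diff[OF sym] xstar ux Q_xstar[unfolded Q_def]
      by (simp add: power2_eq_square)
    have Qu: "u\<^sup>2 * A \<le> Q x" using Q_nonneg[of "x - u *\<^sub>R xstar"] Qd by simp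
    then have "sqrt (u\<^sup>2 * A) \<le> sqrt (Q x)" by simp
    then have sq: "\<bar>u\<bar> * sqrt A \<le> sqrt (Q x)" by (simp add: real_sqrt_mult)
    have B1_eq: "B1 = - c7 * A" by (simp add: B1_def A_def xstar_def)
    have B2_eq: "B2 = c6 * A - c9 * sqrt A" using c7 by (simp add: B2_def B1_eq)
    have q_eq: "q = Min {(- (c6 * A - c9 * sqrt A) -
        sqrt ((c6 * A - c9 * sqrt A)\<^sup>2 - 4 * (- c7 * A) * B3)) / (2 * (- c7 * A)), c6 / (2 * c7), q3}"
      by (simp add: q_def q1_def q2_def B1_eq B2_eq)
    have c7Qu: "c7 * (u\<^sup>2 * A) \<le> c7 * Q x" using Qu c7 by simp
    have "c9 * (\<bar>u\<bar> * sqrt A) \<le> c9 * sqrt (Q x)" using mult_left_mono[OF sq c9] .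
    then have "0 \<le> B3 + c6 * (u * A) - c7 * (u\<^sup>2 * A) - c9 * (\<bar>u\<bar> * sqrt A)"
      using x c7Qu unfolding feasible_iff ux by linarith
    \<comment> \<open>As \<open>A\<close> is positive, the drift ceiling for
      \<open>v *\<^sub>R xstar\<close> is the bound \<open>q3\<close> on \<open>v\<close>.\<close>
    moreover have q3: "v \<le> q3 \<longleftrightarrow> v * A + r \<le> c0" for v
      using \<open>0 < A\<close> by (auto simp: q3_def A_def[symmetric] xstar_def[symmetric] pos_le_divide_eq)
    moreover have "u \<le> q3" using x by (simp add: q3 feasible_iff ux)
    ultimately have q: "0 \<le> B3 + c6 * (q * A) - c7 * (q\<^sup>2 * A) - c9 * (\<bar>q\<bar> * sqrt A)" "q \<le> q3"
      and less: "u \<noteq> q \<Longrightarrow> c6 * (u * A) - c7 * (u\<^sup>2 * A) < c6 * (q * A) - c7 * (q\<^sup>2 * A)"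
      using scalar_mean_variance_optimum[OF \<open>0 < A\<close> c6 c7 c9, of B3 u q3] unfolding q_eq by blast+
    have Qq: "Q (q *\<^sub>R xstar) = q\<^sup>2 * A" and eq: "excess \<bullet> (q *\<^sub>R xstar) = q * A"
      using Q_xstar by (simp_all add: Q_def quad_form_scaleR A_def)
    have "feasible (q *\<^sub>R xstar)"
      using q unfolding feasible_iff Qq eq q3 real_sqrt_mult real_sqrt_abs by simp
    moreover have "integral\<^sup>L M (W x) < integral\<^sup>L M (W (q *\<^sub>R xstar))" if "x \<noteq> q *\<^sub>R xstar"
    \<comment> \<open>If the coefficients agree, \<open>x\<close> differs from its projection and
      carries strictly more risk; otherwise the scalar problem gives strictness.\<close>
    proof (cases "u = q")
      case True
      then have "0 < Q (x - u *\<^sub>R xstar)" using that by (intro Q_pos) simp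
      then have "c7 * (q\<^sup>2 * A) < c7 * Q x" using True Qd c7 by simp
      then show ?thesis unfolding mean Qq eq ux True by linarith
    next
      case False
      then show ?thesis using less c7Qu unfolding mean Qq eq ux by linarith
    qed
    ultimately show ?thesis by blast
  qed
  \<comment> \<open>Strict superiority over every other feasible portfolio yields uniqueness.
    Without feasible portfolios there is no maximizer, and both claims hold vacuously.\<close>
  show ?thesis
    using optimal unfolding is_arg_max_def by (metis less_asym)
qed

end
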